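(* Let $f$ be a smooth $2\pi$-periodic real-valued function, regarded as a function on the circle $S^1=\mathbb{R}/2\pi\mathbb{Z}$, and let $n\ge 1$. For $t\in S^1$ let $g_t$ be the osculating trigonometric polynomial of degree $n$ of $f$ at $t$. Let $I\subset S^1$ be an interval such that for every $t\in I$ the polynomial $g_t$ does not hyper-osculate $f$ at $t$. Then for any distinct $a,b\in I$, the graphs of the osculating trigonometric polynomials $g_a$ and $g_b$ are disjoint, i.e. $g_a(x)\neq g_b(x)$ for all $x\in S^1$.
   Context: A trigonometric polynomial of degree $n$ is a function of the form $g(x)=c+\sum_{i=1}^n (a_i\cos ix+b_i\sin ix)$ with real coefficients. The osculating trigonometric polynomial $g_t$ of degree $n$ of $f$ at $t$ is the (existing and unique) trigonometric polynomial of degree $n$ whose value and first $2n$ derivatives at $t$ coincide with those of $f$: $g_t^{(j)}(t)=f^{(j)}(t)$ for $j=0,\dots,2n$, where derivatives are with respect to $x$. It is hyper-osculating (at $t$) if moreover $g_t^{(2n+1)}(t)=f^{(2n+1)}(t)$. *)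

theory Defs
  imports "HOL-Analysis.Analysis"
begin

definition smooth :: "(real \<Rightarrow> real) \<Rightarrow> bool" where
  "smooth f \<longleftrightarrow> (\<forall>k x. (deriv ^^ k) f differentiable at x)"

text \<open>``Degree n'' means degree at most n: the top coefficients may vanish.\<close>

definition trig_poly :: "nat \<Rightarrow> (real \<Rightarrow> real) \<Rightarrow> bool" where
  "trig_poly n g \<longleftrightarrow>
     (\<exists>(c::real) (a :: nat \<Rightarrow> real) (b :: nat \<Rightarrow> real).
        \<forall>x. g x = c + (\<Sum>i=1..n. a i * cos (real i * x) + b i * sin (real i * x)))"

text \<open>The definite description is justified because, for every \<open>f\<close> and \<open>t\<close>, exactly one
  trigonometric polynomial of degree n has the prescribed 2n + 1 derivatives at \<open>t\<close>.\<close>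

definition osc_trig_poly :: "nat \<Rightarrow> (real \<Rightarrow> real) \<Rightarrow> real \<Rightarrow> (real \<Rightarrow> real)" where
  "osc_trig_poly n f t =
     (THE g. trig_poly n g \<and> (\<forall>j\<le>2 * n. (deriv ^^ j) g t = (deriv ^^ j) f t))"

definition hyper_osculates_at :: "nat \<Rightarrow> (real \<Rightarrow> real) \<Rightarrow> real \<Rightarrow> bool" where
  "hyper_osculates_at n f t \<longleftrightarrow>
     (deriv ^^ (2 * n + 1)) (osc_trig_poly n f t) t = (deriv ^^ (2 * n + 1)) f t"

text \<open>Points of the circle \<open>\<real>/2\<pi>\<int>\<close> are represented by real numbers; \<open>cis s = cis t\<close> holds
  iff \<open>s\<close> and \<open>t\<close> represent the same point. An interval of the circle is represented by a real
  interval projecting onto it.\<close>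

end

theory Submission
  imports Defs
begin

text \<open>
  Fix \<open>x\<close> and consider how \<open>g\<^sub>t(x)\<close> depends on \<open>t\<close>. Differentiating the osculation conditions
  \<open>g\<^sub>t\<^sup>(\<^sup>j\<^sup>)(t) = f\<^sup>(\<^sup>j\<^sup>)(t)\<close> with respect to \<open>t\<close> shows that the trigonometric polynomial
  \<open>\<partial>g\<^sub>t/\<partial>t\<close> vanishes at \<open>t\<close> to order \<open>2n\<close>, and that its derivative of order \<open>2n\<close> at \<open>t\<close> is the
  defect \<open>c(t) = f\<^sup>(\<^sup>2\<^sup>n\<^sup>+\<^sup>1\<^sup>)(t) - g\<^sub>t\<^sup>(\<^sup>2\<^sup>n\<^sup>+\<^sup>1\<^sup>)(t)\<close> of hyper-osculation. A trigonometric polynomial of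
  degree \<open>n\<close> is determined by its first \<open>2n + 1\<close> derivatives at a point
  (\<open>trig_poly_eqI\<close>), so \<open>\<partial>g\<^sub>t(x)/\<partial>t\<close> is \<open>c(t)\<close> times a positive multiple of
  \<open>sin\<^sup>2\<^sup>n((x - t)/2)\<close> (\<open>DERIV_osc_trig_poly\<close>). If \<open>g\<^sub>t\<close> never hyper-osculates on an interval,
  then the continuous function \<open>c\<close> has constant sign there, and since the zeros of the sine are
  isolated, \<open>t \<mapsto> g\<^sub>t(x)\<close> is strictly monotone.

  To make the dependence on \<open>t\<close> explicit, \<open>g\<^sub>t\<close> is written in the basis dual to the functionals
  \<open>p \<mapsto> p\<^sup>(\<^sup>j\<^sup>)(0)\<close>, \<open>j \<le> 2n\<close>. This basis is generated from \<open>sin\<^sup>2\<^sup>n(x/2)\<close> by differentiation. Facts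
  about the order of vanishing are obtained by induction on \<open>n\<close>, since
  \<open>g \<mapsto> g'' + n\<^sup>2 g\<close> lowers the degree of a trigonometric polynomial from \<open>n\<close> to \<open>n - 1\<close>.
\<close>

section \<open>Iterated derivatives of smooth functions\<close>

lemma smooth_DERIV:
  assumes "smooth f"
  shows "((deriv ^^ k) f has_real_derivative (deriv ^^ Suc k) f x) (at x)"
proof -
  have "(deriv ^^ k) f field_differentiable at x"
    using assms by (simp add: smooth_def field_differentiable_def real_differentiable_def)
  thus ?thesis by (simp add: field_differentiable_derivI)
qed

lemma smooth_deriv: "smooth f \<Longrightarrow> smooth (deriv f)"
  unfolding smooth_def by (metis funpow_Suc_right comp_apply)

lemma higher_deriv_linear:
  assumes "smooth f" "smooth g"
  shows "(deriv ^^ k) (\<lambda>x. a * f x + b * g x)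
         = (\<lambda>x. a * (deriv ^^ k) f x + b * (deriv ^^ k) g x)"
proof (induction k)
  case (Suc k)
  have "deriv (\<lambda>x. a * (deriv ^^ k) f x + b * (deriv ^^ k) g x) x
        = a * (deriv ^^ Suc k) f x + b * (deriv ^^ Suc k) g x" for x
    by (rule DERIV_imp_deriv) (intro DERIV_add DERIV_cmult smooth_DERIV assms)
  thus ?case using Suc by auto
qed simp

lemma higher_deriv_sum:
  assumes "\<And>i. i \<in> A \<Longrightarrow> smooth (f i)"
  shows "(deriv ^^ k) (\<lambda>x. \<Sum>i\<in>A. c i * f i x) = (\<lambda>x. \<Sum>i\<in>A. c i * (deriv ^^ k) (f i) x)"
proof (induction k)
  case (Suc k)
  have "deriv (\<lambda>x. \<Sum>i\<in>A. c i * (deriv ^^ k) (f i) x) x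
        = (\<Sum>i\<in>A. c i * (deriv ^^ Suc k) (f i) x)" for x
    by (rule DERIV_imp_deriv) (intro DERIV_sum DERIV_cmult smooth_DERIV assms)
  thus ?case using Suc by auto
qed simp

lemma higher_deriv_shift:
  assumes "smooth f"
  shows "(deriv ^^ k) (\<lambda>x. f (x - t)) = (\<lambda>x. (deriv ^^ k) f (x - t))"
proof (induction k)
  case (Suc k)
  have "deriv (\<lambda>x. (deriv ^^ k) f (x - t)) x = (deriv ^^ Suc k) f (x - t)" for x
  proof (rule DERIV_imp_deriv)
    show "((\<lambda>x. (deriv ^^ k) f (x - t)) has_real_derivative (deriv ^^ Suc k) f (x - t)) (at x)"
      using DERIV_shift[of "(deriv ^^ k) f" "(deriv ^^ Suc k) f (x - t)" x "- t"]
        smooth_DERIV[OF assms, of k "x - t"] by simp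
  qed
  thus ?case using Suc by auto
qed simp

section \<open>Trigonometric polynomials\<close>

text \<open>The constant term is the coefficient of \<open>cos 0x\<close>.\<close>

lemma trig_poly_iff:
  "trig_poly n g \<longleftrightarrow>
     (\<exists>a b. g = (\<lambda>x. \<Sum>i\<le>n. a i * cos (real i * x) + b i * sin (real i * x)))"
proof
  assume "trig_poly n g"
  then obtain c a b where g: "\<And>x. g x = c + (\<Sum>i=1..n. a i * cos (real i * x) + b i * sin (real i * x))"
    unfolding trig_poly_def by blast
  have "g x = (\<Sum>i\<le>n. (a(0 := c)) i * cos (real i * x) + b i * sin (real i * x))" for x
  proof -
    have "(\<Sum>i\<in>{..n} - {0}. (a(0 := c)) i * cos (real i * x) + b i * sin (real i * x))
       = (\<Sum>i=1..n. a i * cos (real i * x) + b i * sin (real i * x))"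
      by (rule sum.cong) auto
    thus ?thesis by (simp add: sum.remove[of "{..n}" 0] g)
  qed
  thus "\<exists>a b. g = (\<lambda>x. \<Sum>i\<le>n. a i * cos (real i * x) + b i * sin (real i * x))" by blast
next
  assume "\<exists>a b. g = (\<lambda>x. \<Sum>i\<le>n. a i * cos (real i * x) + b i * sin (real i * x))"
  then obtain a b where g: "g = (\<lambda>x. \<Sum>i\<le>n. a i * cos (real i * x) + b i * sin (real i * x))"
    by blast
  have "{..n} - {0} = {1..n}" by auto
  hence "g x = a 0 + (\<Sum>i=1..n. a i * cos (real i * x) + b i * sin (real i * x))" for x
    by (simp add: sum.remove[of "{..n}" 0] g)
  thus "trig_poly n g" unfolding trig_poly_def by blast
qed

lemma trig_polyI:
  assumes "\<And>x. g x = (\<Sum>i\<le>n. a i * cos (real i * x) + b i * sin (real i * x))"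
  shows "trig_poly n g"
  using assms unfolding trig_poly_iff by blast

lemma trig_polyE:
  assumes "trig_poly n g"
  obtains a b where "g = (\<lambda>x. \<Sum>i\<le>n. a i * cos (real i * x) + b i * sin (real i * x))"
  using assms unfolding trig_poly_iff by blast

lemma trig_poly_linear:
  assumes "trig_poly n f" "trig_poly n g"
  shows "trig_poly n (\<lambda>x. r * f x + s * g x)"
proof -
  obtain a b where f: "f = (\<lambda>x. \<Sum>i\<le>n. a i * cos (real i * x) + b i * sin (real i * x))"
    using assms(1) by (rule trig_polyE)
  obtain a' b' where g: "g = (\<lambda>x. \<Sum>i\<le>n. a' i * cos (real i * x) + b' i * sin (real i * x))"
    using assms(2) by (rule trig_polyE)
  have "r * f x + s * g x = (\<Sum>i\<le>n. (r * a i + s * a' i) * cos (real i * x)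
                                       + (r * b i + s * b' i) * sin (real i * x))" for x
    by (auto simp: f g sum_distrib_left sum.distrib algebra_simps)
  thus ?thesis by (rule trig_polyI)
qed

lemma trig_poly_zero: "trig_poly n (\<lambda>x. 0)"
  by (rule trig_polyI[of _ "\<lambda>_. 0" "\<lambda>_. 0"]) simp

lemma trig_poly_add:
  "trig_poly n f \<Longrightarrow> trig_poly n g \<Longrightarrow> trig_poly n (\<lambda>x. f x + g x)"
  using trig_poly_linear[of n f g 1 1] by simp

lemma trig_poly_cmult: "trig_poly n f \<Longrightarrow> trig_poly n (\<lambda>x. r * f x)"
  using trig_poly_linear[of n f f r 0] by simp

lemma trig_poly_sum:
  "(\<And>i. i \<in> A \<Longrightarrow> trig_poly n (f i)) \<Longrightarrow> trig_poly n (\<lambda>x. \<Sum>i\<in>A. f i x)"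
  by (induction A rule: infinite_finite_induct) (simp_all add: trig_poly_zero trig_poly_add)

lemma trig_poly_cos:
  assumes "k \<le> n"
  shows "trig_poly n (\<lambda>x. cos (real k * x))"
proof -
  have "cos (real k * x) = (\<Sum>i\<le>n. (if i = k then 1 else 0) * cos (real i * x) + 0 * sin (real i * x))" for x
    using assms by (simp add: if_distrib[of "\<lambda>u. u * _"] cong: if_cong)
  thus ?thesis by (rule trig_polyI)
qed

lemma trig_poly_sin:
  assumes "k \<le> n"
  shows "trig_poly n (\<lambda>x. sin (real k * x))"
proof -
  have "sin (real k * x) = (\<Sum>i\<le>n. 0 * cos (real i * x) + (if i = k then 1 else 0) * sin (real i * x))" for x
    using assms by (simp add: if_distrib[of "\<lambda>u. u * _"] cong: if_cong)
  thus ?thesis by (rule trig_polyI)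
qed

lemma trig_poly_has_deriv:
  assumes "trig_poly n g"
  shows "(g has_real_derivative deriv g x) (at x)" and "trig_poly n (deriv g)"
proof -
  obtain a b where g: "g = (\<lambda>x. \<Sum>i\<le>n. a i * cos (real i * x) + b i * sin (real i * x))"
    using assms(1) by (rule trig_polyE)
  let ?d = "\<lambda>x. \<Sum>i\<le>n. (real i * b i) * cos (real i * x) + (- real i * a i) * sin (real i * x)"
  have D: "(g has_real_derivative ?d x) (at x)" for x
    unfolding g by (auto intro!: derivative_eq_intros sum.cong simp: algebra_simps)
  hence d: "deriv g = ?d" by (auto intro: DERIV_imp_deriv)
  show "(g has_real_derivative deriv g x) (at x)" using D d by metis
  show "trig_poly n (deriv g)" unfolding d by (rule trig_polyI) (rule refl)
qed

lemma trig_poly_higher_deriv: "trig_poly n g \<Longrightarrow> trig_poly n ((deriv ^^ k) g)"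
  by (induction k) (simp_all add: trig_poly_has_deriv)

lemma trig_poly_smooth: "trig_poly n g \<Longrightarrow> smooth g"
  unfolding smooth_def
  by (meson trig_poly_higher_deriv trig_poly_has_deriv(1) real_differentiable_def)

lemma trig_poly_shift:
  assumes "trig_poly n g"
  shows "trig_poly n (\<lambda>x. g (x - t))"
proof -
  obtain a b where g: "g = (\<lambda>x. \<Sum>i\<le>n. a i * cos (real i * x) + b i * sin (real i * x))"
    using assms(1) by (rule trig_polyE)
  have "g (x - t) =
     (\<Sum>i\<le>n. (a i * cos (real i * t) - b i * sin (real i * t)) * cos (real i * x)
           + (a i * sin (real i * t) + b i * cos (real i * t)) * sin (real i * x))" for x
    by (auto simp: g right_diff_distrib cos_diff sin_diff algebra_simps intro!: sum.cong)
  thus ?thesis by (rule trig_polyI)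
qed

lemma trig_poly_mult_cos:
  assumes "trig_poly n g"
  shows "trig_poly (Suc n) (\<lambda>x. g x * cos x)"
proof -
  obtain a b where g: "g = (\<lambda>x. \<Sum>i\<le>n. a i * cos (real i * x) + b i * sin (real i * x))"
    using assms(1) by (rule trig_polyE)
  have c: "trig_poly (Suc n) (\<lambda>x. cos (real i * x) * cos x)" if "i \<le> n" for i
  proof (cases i)
    case 0
    then show ?thesis using trig_poly_cos[of 1 "Suc n"] by simp
  next
    case (Suc j)
    have "cos (real i * x) * cos x = 1/2 * cos (real j * x) + 1/2 * cos (real (Suc i) * x)" for x
      using cos_times_cos[of "real i * x" x] by (simp add: Suc algebra_simps add_divide_distrib)
    thus ?thesis
      using trig_poly_linear[OF trig_poly_cos[of j "Suc n"] trig_poly_cos[of "Suc i" "Suc n"], of "1/2" "1/2"]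
        that Suc by simp
  qed
  have s: "trig_poly (Suc n) (\<lambda>x. sin (real i * x) * cos x)" if "i \<le> n" for i
  proof (cases i)
    case 0
    then show ?thesis using trig_poly_zero by simp
  next
    case (Suc j)
    have "sin (real i * x) * cos x = 1/2 * sin (real j * x) + 1/2 * sin (real (Suc i) * x)" for x
      using sin_times_cos[of "real i * x" x] by (simp add: Suc algebra_simps add_divide_distrib)
    thus ?thesis
      using trig_poly_linear[OF trig_poly_sin[of j "Suc n"] trig_poly_sin[of "Suc i" "Suc n"], of "1/2" "1/2"]
        that Suc by simp
  qed
  have "trig_poly (Suc n) (\<lambda>x. \<Sum>i\<le>n. a i * (cos (real i * x) * cos x) + b i * (sin (real i * x) * cos x))"
    by (intro trig_poly_sum trig_poly_linear c s) auto
  moreover have "(\<lambda>x. g x * cos x)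
    = (\<lambda>x. \<Sum>i\<le>n. a i * (cos (real i * x) * cos x) + b i * (sin (real i * x) * cos x))"
    by (auto simp: g sum_distrib_right distrib_right mult.assoc)
  ultimately show ?thesis by simp
qed

lemma trig_poly_mono:
  assumes "trig_poly m g" "m \<le> n"
  shows "trig_poly n g"
proof -
  obtain a b where g: "g = (\<lambda>x. \<Sum>i\<le>m. a i * cos (real i * x) + b i * sin (real i * x))"
    using assms(1) by (rule trig_polyE)
  show ?thesis unfolding g using assms(2)
    by (intro trig_poly_sum trig_poly_linear trig_poly_cos trig_poly_sin) auto
qed

lemma trig_poly_degree_lowering:
  assumes "trig_poly (Suc n) g"
  shows "trig_poly n (\<lambda>x. deriv (deriv g) x + (real (Suc n))\<^sup>2 * g x)"
proof -
  obtain a b where g: "g = (\<lambda>x. \<Sum>i\<le>Suc n. a i * cos (real i * x) + b i * sin (real i * x))"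
    using assms(1) by (rule trig_polyE)
  have "deriv g x = (\<Sum>i\<le>Suc n. real i * (b i * cos (real i * x) - a i * sin (real i * x)))" for x
    unfolding g
    by (rule DERIV_imp_deriv) (auto intro!: derivative_eq_intros sum.cong simp: algebra_simps)
  hence d1: "deriv g = (\<lambda>x. \<Sum>i\<le>Suc n. real i * (b i * cos (real i * x) - a i * sin (real i * x)))"
    by blast
  have d2: "deriv (deriv g) x = (\<Sum>i\<le>Suc n. - (real i)\<^sup>2 * (a i * cos (real i * x) + b i * sin (real i * x)))" for x
    unfolding d1
    by (rule DERIV_imp_deriv)
       (auto intro!: derivative_eq_intros sum.cong simp: algebra_simps power2_eq_square)
  \<comment> \<open>The terms of frequency \<open>n + 1\<close> cancel.\<close>
  have "deriv (deriv g) x + (real (Suc n))\<^sup>2 * g x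
     = (\<Sum>i\<le>Suc n. ((real (Suc n))\<^sup>2 - (real i)\<^sup>2) * (a i * cos (real i * x) + b i * sin (real i * x)))" for x
    unfolding d2 by (subst g, simp only: sum_distrib_left sum.distrib[symmetric])
      (rule sum.cong[OF refl], algebra)
  hence "deriv (deriv g) x + (real (Suc n))\<^sup>2 * g x
     = (\<Sum>i\<le>n. (((real (Suc n))\<^sup>2 - (real i)\<^sup>2) * a i) * cos (real i * x)
            + (((real (Suc n))\<^sup>2 - (real i)\<^sup>2) * b i) * sin (real i * x))" for x
    by (auto intro!: sum.cong simp: distrib_left mult.assoc)
  thus ?thesis by (rule trig_polyI)
qed

section \<open>Uniqueness of the osculating polynomial\<close>

lemma harmonic_oscillator_unique:
  fixes g :: "real \<Rightarrow> real"
  assumes "\<And>x. (g has_real_derivative g' x) (at x)"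
    and "\<And>x. (g' has_real_derivative - w\<^sup>2 * g x) (at x)"
    and "w \<noteq> 0" "g t = 0" "g' t = 0"
  shows "g x = 0"
proof -
  \<comment> \<open>The energy is conserved.\<close>
  have "((\<lambda>x. (g' x)\<^sup>2 + w\<^sup>2 * (g x)\<^sup>2) has_real_derivative 0) (at y)" for y
    by (rule derivative_eq_intros assms(1,2) refl)+ (simp add: algebra_simps)
  hence "(g' x)\<^sup>2 + w\<^sup>2 * (g x)\<^sup>2 = (g' t)\<^sup>2 + w\<^sup>2 * (g t)\<^sup>2"
    using DERIV_isconst_all by blast
  hence "w\<^sup>2 * (g x)\<^sup>2 = 0"
    using assms by (simp add: add_nonneg_eq_0_iff)
  thus ?thesis using assms by simp
qed

lemma higher_deriv_degree_lowering:
  assumes "smooth g"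
  shows "(deriv ^^ j) (\<lambda>x. deriv (deriv g) x + w * g x) t
         = (deriv ^^ (j + 2)) g t + w * (deriv ^^ j) g t"
proof -
  have "deriv (deriv g) = (deriv ^^ 2) g" by (simp add: eval_nat_numeral)
  hence "(deriv ^^ j) (deriv (deriv g)) = (deriv ^^ (j + 2)) g"
    by (metis comp_apply funpow_add)
  thus ?thesis
    using higher_deriv_linear[OF smooth_deriv[OF smooth_deriv[OF assms]] assms, of j 1 w] by simp
qed

lemma trig_poly_eq_0I:
  assumes "trig_poly n g" "\<And>j. j \<le> 2 * n \<Longrightarrow> (deriv ^^ j) g t = 0"
  shows "g x = 0"
  using assms
proof (induction n arbitrary: g x)
  case 0
  then obtain c where "\<And>x. g x = c" unfolding trig_poly_def by auto
  moreover have "g t = 0" using "0.prems"(2)[of 0] by simp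
  ultimately show ?case by simp
next
  case (Suc n)
  let ?w = "real (Suc n)"
  have sm: "smooth g" using Suc.prems(1) by (rule trig_poly_smooth)
  have "(deriv ^^ j) (\<lambda>x. deriv (deriv g) x + ?w\<^sup>2 * g x) t = 0" if "j \<le> 2 * n" for j
    using Suc.prems(2)[of j] Suc.prems(2)[of "j + 2"] that
    by (simp add: higher_deriv_degree_lowering[OF sm] del: of_nat_Suc funpow.simps)
  hence "deriv (deriv g) x + ?w\<^sup>2 * g x = 0" for x
    by (rule Suc.IH[OF trig_poly_degree_lowering[OF Suc.prems(1)]])
  hence *: "deriv (deriv g) x = - ?w\<^sup>2 * g x" for x
    by (simp add: eq_neg_iff_add_eq_0)
  show ?case
  proof (rule harmonic_oscillator_unique[of g "deriv g" ?w t])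
    show "(g has_real_derivative deriv g x) (at x)" for x
      by (rule trig_poly_has_deriv[OF Suc.prems(1)])
    show "(deriv g has_real_derivative - ?w\<^sup>2 * g x) (at x)" for x
      unfolding *[symmetric] by (intro trig_poly_has_deriv[of "Suc n"] Suc.prems)
    show "g t = 0" "deriv g t = 0"
      using Suc.prems(2)[of 0] Suc.prems(2)[of 1] by simp_all
  qed simp
qed

lemma trig_poly_eqI:
  assumes "trig_poly n g" "trig_poly n h"
    and "\<And>j. j \<le> 2 * n \<Longrightarrow> (deriv ^^ j) g t = (deriv ^^ j) h t"
  shows "g = h"
proof
  fix x
  have "(\<lambda>x. 1 * g x + (-1) * h x) x = 0"
  proof (rule trig_poly_eq_0I[of n "\<lambda>x. 1 * g x + (-1) * h x" t x])
    show "trig_poly n (\<lambda>x. 1 * g x + (-1) * h x)" by (intro trig_poly_linear assms)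
    show "(deriv ^^ j) (\<lambda>x. 1 * g x + (-1) * h x) t = 0" if "j \<le> 2 * n" for j
      using assms(3)[OF that] assms(1,2)
      by (subst higher_deriv_linear) (auto intro: trig_poly_smooth)
  qed
  thus "g x = h x" by simp
qed

section \<open>A basis dual to the derivatives at the origin\<close>

lemma trig_poly_sin_power: "trig_poly n (\<lambda>x. sin (x / 2) ^ (2 * n))"
proof (induction n)
  case 0
  show ?case using trig_poly_cos[of 0 0] by simp
next
  case (Suc n)
  have "sin (x / 2) ^ (2 * Suc n)
     = 1/2 * sin (x / 2) ^ (2 * n) + (-1/2) * (sin (x / 2) ^ (2 * n) * cos x)" for x :: real
  proof -
    have "cos x = 1 - 2 * (sin (x / 2))\<^sup>2" using cos_double_sin[of "x / 2"] by simp
    moreover have "sin (x / 2) ^ (2 * Suc n) = (sin (x / 2))\<^sup>2 * sin (x / 2) ^ (2 * n)"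
      by (simp add: power2_eq_square)
    ultimately show ?thesis by (simp only:) (simp add: algebra_simps)
  qed
  thus ?case
    using trig_poly_linear[OF trig_poly_mono[OF Suc] trig_poly_mult_cos[OF Suc], of "1/2" "-1/2"]
    by simp
qed

lemma sin_power_degree_lowering:
  defines "K \<equiv> \<lambda>n x :: real. sin (x / 2) ^ (2 * n)"
  shows "deriv (deriv (K (Suc n))) x + (real (Suc n))\<^sup>2 * K (Suc n) x
       = (real (Suc n) * (2 * real n + 1) / 2) * K n x"
    and "deriv (K (Suc n)) 0 = 0"
proof -
  have P: "((\<lambda>x. sin (x / 2) ^ Suc m) has_real_derivative
            real (Suc m) * sin (x / 2) ^ m * (cos (x / 2) / 2)) (at x)" for m and x :: real
  proof -
    have "((\<lambda>x::real. sin (x / 2)) has_real_derivative cos (x / 2) / 2) (at x)"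
      by (auto intro!: derivative_eq_intros)
    from DERIV_power[OF this, of "Suc m"] show ?thesis
      by (rule DERIV_cong) simp
  qed
  have "deriv (K (Suc n)) x = real (Suc n) * (sin (x / 2) ^ Suc (2 * n) * cos (x / 2))" for x
  proof -
    have "(K (Suc n) has_real_derivative
            real (2 * n + 2) * sin (x / 2) ^ Suc (2 * n) * (cos (x / 2) / 2)) (at x)"
      using P[of "Suc (2 * n)" x] by (simp only: K_def mult_Suc_right add_2_eq_Suc add_2_eq_Suc')
    moreover have "real (2 * n + 2) * sin (x / 2) ^ Suc (2 * n) * (cos (x / 2) / 2)
        = real (Suc n) * (sin (x / 2) ^ Suc (2 * n) * cos (x / 2))"
      by (simp add: field_simps)
    ultimately show ?thesis by (metis DERIV_imp_deriv)
  qed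
  hence d1: "deriv (K (Suc n)) = (\<lambda>x. real (Suc n) * (sin (x / 2) ^ Suc (2 * n) * cos (x / 2)))"
    by blast
  show "deriv (K (Suc n)) 0 = 0" by (simp add: d1)
  have "((\<lambda>x::real. cos (x / 2)) has_real_derivative - sin (x / 2) / 2) (at x)"
    by (auto intro!: derivative_eq_intros)
  hence "deriv (deriv (K (Suc n))) x = real (Suc n) *
      (real (Suc (2 * n)) * sin (x / 2) ^ (2 * n) * (cos (x / 2) / 2) * cos (x / 2)
        + (- sin (x / 2) / 2) * sin (x / 2) ^ Suc (2 * n))"
    unfolding d1 by (intro DERIV_imp_deriv DERIV_cmult DERIV_mult P)
  also have "\<dots> = real (Suc n) *
      ((2 * real n + 1) / 2 * sin (x / 2) ^ (2 * n) * (cos (x / 2))\<^sup>2 - sin (x / 2) ^ (2 * n + 2) / 2)"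
    by (simp add: power2_eq_square field_simps)
  also have "(cos (x / 2))\<^sup>2 = 1 - (sin (x / 2))\<^sup>2" by (rule cos_squared_eq)
  finally show "deriv (deriv (K (Suc n))) x + (real (Suc n))\<^sup>2 * K (Suc n) x
       = (real (Suc n) * (2 * real n + 1) / 2) * K n x"
    by (simp add: K_def field_simps power2_eq_square)
qed

lemma higher_deriv_sin_power:
  shows "j < 2 * n \<Longrightarrow> (deriv ^^ j) (\<lambda>x::real. sin (x / 2) ^ (2 * n)) 0 = 0"
    and "(deriv ^^ (2 * n)) (\<lambda>x::real. sin (x / 2) ^ (2 * n)) 0 > 0"
proof -
  define K where "K = (\<lambda>n x :: real. sin (x / 2) ^ (2 * n))"
  have "(\<forall>j<2*n. (deriv ^^ j) (K n) 0 = 0) \<and> (deriv ^^ (2 * n)) (K n) 0 > 0"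
  proof (induction n)
    case 0
    show ?case by (simp add: K_def)
  next
    case (Suc n)
    define C where "C = real (Suc n) * (2 * real n + 1) / 2"
    have "C > 0" by (simp add: C_def)
    have smK: "smooth (K m)" for m
      unfolding K_def by (rule trig_poly_smooth[OF trig_poly_sin_power])
    have "(\<lambda>x. deriv (deriv (K (Suc n))) x + (real (Suc n))\<^sup>2 * K (Suc n) x)
          = (\<lambda>x. C * K n x + 0 * K n x)"
      unfolding K_def C_def
      by (intro ext) (simp only: sin_power_degree_lowering(1) mult_zero_left add_0_right)
    from arg_cong[OF this, of "\<lambda>h. (deriv ^^ _) h 0"]
    have rec: "(deriv ^^ (j + 2)) (K (Suc n)) 0
        = C * (deriv ^^ j) (K n) 0 - (real (Suc n))\<^sup>2 * (deriv ^^ j) (K (Suc n)) 0" for j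
      unfolding higher_deriv_degree_lowering[OF smK] higher_deriv_linear[OF smK smK]
      by (simp add: algebra_simps)
    have van: "(deriv ^^ j) (K (Suc n)) 0 = 0" if "j < 2 * Suc n" for j
      using that
    proof (induction j rule: less_induct)
      case (less j)
      consider "j = 0" | "j = 1" | i where "j = i + 2"
        by (metis One_nat_def add_2_eq_Suc' not0_implies_Suc)
      thus ?case
      proof cases
        case 1
        then show ?thesis by (simp add: K_def)
      next
        case 2
        then show ?thesis using sin_power_degree_lowering(2)[of n] by (simp add: K_def)
      next
        case 3
        then show ?thesis using rec[of i] less Suc by simp
      qed
    qed
    have "(deriv ^^ (2 * n + 2)) (K (Suc n)) 0 = C * (deriv ^^ (2 * n)) (K n) 0"
      using rec[of "2 * n"] van[of "2 * n"] by simp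
    hence "(deriv ^^ (2 * Suc n)) (K (Suc n)) 0 > 0"
      using Suc \<open>C > 0\<close> by simp
    with van show ?case by blast
  qed
  thus "j < 2 * n \<Longrightarrow> (deriv ^^ j) (\<lambda>x::real. sin (x / 2) ^ (2 * n)) 0 = 0"
    and "(deriv ^^ (2 * n)) (\<lambda>x::real. sin (x / 2) ^ (2 * n)) 0 > 0"
    by (auto simp: K_def)
qed

text \<open>The function \<open>sin\<^sup>2\<^sup>n(x/2)\<close>, scaled so that its derivative of order \<open>2n\<close> at the origin, which
  is the first one not to vanish, equals 1.\<close>

definition osc_kernel :: "nat \<Rightarrow> real \<Rightarrow> real" where
  "osc_kernel n x = sin (x / 2) ^ (2 * n) / (deriv ^^ (2 * n)) (\<lambda>x. sin (x / 2) ^ (2 * n)) 0"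

text \<open>The dual basis, indexed downwards: \<open>dual_basis n m\<close>, for \<open>m \<le> 2n\<close>, is the trigonometric
  polynomial of degree \<open>n\<close> whose derivatives of order \<open>0, \<dots>, 2n\<close> at the origin are all 0, except
  that the one of order \<open>2n - m\<close> is 1. Differentiation lowers the order of the nonzero derivative,
  and subtracting a multiple of the kernel restores the one of order \<open>2n\<close> to 0.\<close>

fun dual_basis :: "nat \<Rightarrow> nat \<Rightarrow> real \<Rightarrow> real" where
  "dual_basis n 0 = osc_kernel n"
| "dual_basis n (Suc m) = (\<lambda>x. deriv (dual_basis n m) x
      - (deriv ^^ (2 * n + 1)) (dual_basis n m) 0 * osc_kernel n x)"

lemma trig_poly_osc_kernel: "trig_poly n (osc_kernel n)"
  using trig_poly_cmult[OF trig_poly_sin_power[of n],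
      of "1 / (deriv ^^ (2 * n)) (\<lambda>x. sin (x / 2) ^ (2 * n)) 0"]
  by (simp add: osc_kernel_def[abs_def])

lemma higher_deriv_osc_kernel:
  assumes "j \<le> 2 * n"
  shows "(deriv ^^ j) (osc_kernel n) 0 = (if j = 2 * n then 1 else 0)"
proof -
  let ?K = "\<lambda>x::real. sin (x / 2) ^ (2 * n)"
  let ?d = "(deriv ^^ (2 * n)) ?K 0"
  have sm: "smooth ?K" by (rule trig_poly_smooth[OF trig_poly_sin_power])
  have "osc_kernel n = (\<lambda>x. (1 / ?d) * ?K x + 0 * ?K x)"
    by (simp add: osc_kernel_def[abs_def])
  hence "(deriv ^^ j) (osc_kernel n) 0 = (1 / ?d) * (deriv ^^ j) ?K 0"
    by (simp only: higher_deriv_linear[OF sm sm])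
  thus ?thesis using assms higher_deriv_sin_power(1)[of j n] higher_deriv_sin_power(2)[of n] by auto
qed

lemma osc_kernel_nonneg: "osc_kernel n x \<ge> 0"
  using higher_deriv_sin_power(2)[of n] by (simp add: osc_kernel_def)

lemma osc_kernel_eq_0D: "osc_kernel n x = 0 \<Longrightarrow> sin (x / 2) = 0"
  using higher_deriv_sin_power(2)[of n] by (simp add: osc_kernel_def)

lemma trig_poly_dual_basis: "trig_poly n (dual_basis n m)"
proof (induction m)
  case (Suc m)
  show ?case
    using trig_poly_linear[OF trig_poly_has_deriv(2)[OF Suc] trig_poly_osc_kernel,
        of 1 "- (deriv ^^ (2 * n + 1)) (dual_basis n m) 0"]
    by simp
qed (simp add: trig_poly_osc_kernel)

lemma higher_deriv_dual_basis:
  assumes "j \<le> 2 * n"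
  shows "(deriv ^^ j) (dual_basis n m) 0 = (if j + m = 2 * n then 1 else 0)"
  using assms
proof (induction m arbitrary: j)
  case 0
  thus ?case by (simp add: higher_deriv_osc_kernel)
next
  case (Suc m)
  define \<beta> where "\<beta> = (deriv ^^ (2 * n + 1)) (dual_basis n m) 0"
  have sm: "smooth (deriv (dual_basis n m))" "smooth (osc_kernel n)"
    by (intro smooth_deriv trig_poly_smooth[OF trig_poly_dual_basis]
          trig_poly_smooth[OF trig_poly_osc_kernel])+
  have "dual_basis n (Suc m) = (\<lambda>x. 1 * deriv (dual_basis n m) x + (- \<beta>) * osc_kernel n x)"
    by (simp add: \<beta>_def)
  hence "(deriv ^^ j) (dual_basis n (Suc m)) 0
      = (deriv ^^ Suc j) (dual_basis n m) 0 - \<beta> * (deriv ^^ j) (osc_kernel n) 0"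
    by (simp only: higher_deriv_linear[OF sm]) (simp add: funpow_swap1)
  also have "\<dots> = (if j + Suc m = 2 * n then 1 else 0)"
  proof (cases "j = 2 * n")
    case True
    thus ?thesis using higher_deriv_osc_kernel[of j n] by (simp add: \<beta>_def)
  next
    case False
    hence "Suc j \<le> 2 * n" using Suc.prems by simp
    from Suc.IH[OF this] show ?thesis
      using higher_deriv_osc_kernel[of j n] Suc.prems False by simp
  qed
  finally show ?case .
qed

text \<open>One step beyond the basis the recursion yields the zero function. This is what makes the
  boundary term of the telescoping sum in \<open>DERIV_osc_trig_poly\<close> disappear.\<close>

lemma dual_basis_beyond: "dual_basis n (2 * n + 1) x = 0"
  by (rule trig_poly_eq_0I[OF trig_poly_dual_basis, where t = 0])
     (subst higher_deriv_dual_basis; simp)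

section \<open>Dependence of the osculating polynomial on the point\<close>

lemma osc_trig_poly_eq:
  assumes "smooth f"
  shows "osc_trig_poly n f t
         = (\<lambda>x. \<Sum>m\<le>2*n. (deriv ^^ (2 * n - m)) f t * dual_basis n m (x - t))" (is "_ = ?g")
    and "(deriv ^^ k) (osc_trig_poly n f t) t
         = (\<Sum>m\<le>2*n. (deriv ^^ (2 * n - m)) f t * (deriv ^^ k) (dual_basis n m) 0)"
proof -
  have sm: "smooth (dual_basis n m)" for m
    by (rule trig_poly_smooth[OF trig_poly_dual_basis])
  have "trig_poly n (\<lambda>x. dual_basis n m (x - t))" for m
    by (rule trig_poly_shift[OF trig_poly_dual_basis])
  note tp = this trig_poly_smooth[OF this]
  have g: "trig_poly n ?g" by (intro trig_poly_sum trig_poly_cmult tp)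
  have d: "(deriv ^^ k) ?g t
         = (\<Sum>m\<le>2*n. (deriv ^^ (2 * n - m)) f t * (deriv ^^ k) (dual_basis n m) 0)" for k
    by (simp add: higher_deriv_sum[OF tp(2)] higher_deriv_shift[OF sm])
  have osc: "(deriv ^^ j) ?g t = (deriv ^^ j) f t" if "j \<le> 2 * n" for j
  proof -
    have "(deriv ^^ j) ?g t
        = (\<Sum>m\<le>2*n. if m = 2 * n - j then (deriv ^^ (2 * n - m)) f t else 0)"
      unfolding d using that by (intro sum.cong) (auto simp: higher_deriv_dual_basis)
    thus ?thesis using that by simp
  qed
  show eq: "osc_trig_poly n f t = ?g"
    unfolding osc_trig_poly_def
  proof (rule the_equality)
    show "trig_poly n ?g \<and> (\<forall>j\<le>2 * n. (deriv ^^ j) ?g t = (deriv ^^ j) f t)"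
      using g osc by blast
    show "h = ?g" if "trig_poly n h \<and> (\<forall>j\<le>2 * n. (deriv ^^ j) h t = (deriv ^^ j) f t)" for h
      using that g osc by (intro trig_poly_eqI[of n h ?g t]) auto
  qed
  show "(deriv ^^ k) (osc_trig_poly n f t) t
         = (\<Sum>m\<le>2*n. (deriv ^^ (2 * n - m)) f t * (deriv ^^ k) (dual_basis n m) 0)"
    unfolding eq by (rule d)
qed

text \<open>The amount by which the osculating polynomial fails to hyper-osculate at \<open>t\<close>.\<close>

definition osc_defect :: "nat \<Rightarrow> (real \<Rightarrow> real) \<Rightarrow> real \<Rightarrow> real" where
  "osc_defect n f t =
     (deriv ^^ (2 * n + 1)) f t - (deriv ^^ (2 * n + 1)) (osc_trig_poly n f t) t"

lemma continuous_osc_defect: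
  assumes "smooth f"
  shows "continuous_on S (osc_defect n f)"
proof -
  have "continuous_on S ((deriv ^^ k) f)" for k
    by (intro continuous_at_imp_continuous_on ballI DERIV_isCont[OF smooth_DERIV[OF assms]])
  thus ?thesis
    unfolding osc_defect_def[abs_def] osc_trig_poly_eq(2)[OF assms]
    by (intro continuous_intros)
qed

text \<open>The recursion defining the dual basis expresses the derivative of each basis element
  through the next one and the kernel. Therefore the sum obtained by the product rule telescopes,
  and only multiples of the kernel remain.\<close>

lemma DERIV_osc_trig_poly:
  assumes "smooth f"
  shows "((\<lambda>t. osc_trig_poly n f t x) has_real_derivative
           osc_defect n f t * osc_kernel n (x - t)) (at t)"
proof -
  let ?\<beta> = "\<lambda>m. (deriv ^^ (2 * n + 1)) (dual_basis n m) 0"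
  let ?T = "\<lambda>m. (deriv ^^ (2 * n + 1 - m)) f t * dual_basis n m (x - t)"
  have term_deriv: "((\<lambda>t. (deriv ^^ (2 * n - m)) f t * dual_basis n m (x - t)) has_real_derivative
       ?T m - ?T (Suc m) - (deriv ^^ (2 * n - m)) f t * ?\<beta> m * osc_kernel n (x - t)) (at t)"
    if "m \<le> 2 * n" for m
  proof -
    have f': "((deriv ^^ (2 * n - m)) f has_real_derivative (deriv ^^ (2 * n + 1 - m)) f t) (at t)"
      using smooth_DERIV[OF assms, of "2 * n - m" t] that by (simp add: Suc_diff_le)
    have "((\<lambda>t. dual_basis n m (x - t)) has_real_derivative
            deriv (dual_basis n m) (x - t) * (0 - 1)) (at t)"
      by (rule DERIV_chain2[OF trig_poly_has_deriv(1)[OF trig_poly_dual_basis]])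
         (intro derivative_intros)
    from DERIV_mult[OF f' this] show ?thesis
      by (rule DERIV_cong) (simp add: algebra_simps)
  qed
  have "((\<lambda>t. osc_trig_poly n f t x) has_real_derivative
      (\<Sum>m\<le>2*n. ?T m - ?T (Suc m) - (deriv ^^ (2 * n - m)) f t * ?\<beta> m * osc_kernel n (x - t))) (at t)"
    unfolding osc_trig_poly_eq(1)[OF assms] using term_deriv by (intro DERIV_sum) auto
  moreover have "(\<Sum>m\<le>2*n. ?T m - ?T (Suc m) - (deriv ^^ (2 * n - m)) f t * ?\<beta> m * osc_kernel n (x - t))
      = osc_defect n f t * osc_kernel n (x - t)"
  proof -
    have "(\<Sum>m\<le>2*n. ?T m - ?T (Suc m)) = ?T 0 - ?T (Suc (2 * n))"
      by (rule sum_telescope)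
    also have "\<dots> = (deriv ^^ (2 * n + 1)) f t * osc_kernel n (x - t)"
      using dual_basis_beyond[of n "x - t"] by simp
    finally show ?thesis
      unfolding osc_defect_def osc_trig_poly_eq(2)[OF assms]
      by (simp only: sum_subtractf left_diff_distrib sum_distrib_right)
  qed
  ultimately show ?thesis by simp
qed

lemma continuous_nonzero_constant_sign:
  fixes c :: "real \<Rightarrow> real"
  assumes "is_interval S" "continuous_on S c" "\<And>t. t \<in> S \<Longrightarrow> c t \<noteq> 0"
  obtains \<sigma> :: real where "\<sigma> \<noteq> 0" "\<And>t. t \<in> S \<Longrightarrow> \<sigma> * c t > 0"
proof -
  have "connected (c ` S)"
    using assms by (intro connected_continuous_image is_interval_connected)
  hence int: "is_interval (c ` S)" by (simp add: is_interval_connected_1)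
  have "0 \<notin> c ` S" using assms(3) by force
  hence "\<not> (c s < 0 \<and> 0 < c t)" if "s \<in> S" "t \<in> S" for s t
    using mem_is_interval_1_I[OF int imageI[OF that(1)] imageI[OF that(2)], of 0] by auto
  hence "(\<forall>t\<in>S. c t > 0) \<or> (\<forall>t\<in>S. c t < 0)"
    using assms(3) by (meson linorder_neqE_linordered_idom)
  thus ?thesis
    using that[of 1] that[of "-1"] by auto
qed

lemma exists_sin_nonzero:
  fixes a b :: real
  assumes "a < b"
  shows "\<exists>t. a < t \<and> t < b \<and> sin ((x - t) / 2) \<noteq> 0"
proof (rule ccontr)
  assume contr: "\<not> ?thesis"
  \<comment> \<open>Two common zeros at a positive distance smaller than \<open>2\<pi>\<close> are impossible.\<close>
  define d where "d = min ((b - a) / 3) 1"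
  have d: "0 < d" "d \<le> 1" "a + 2 * d < b"
    using assms by (auto simp: d_def min_def field_simps)
  have z: "sin ((x - (a + d)) / 2) = 0" "sin ((x - (a + 2 * d)) / 2) = 0"
    using contr d by auto
  have "sin ((x - (a + d)) / 2 - (x - (a + 2 * d)) / 2) = 0"
    unfolding sin_diff z by simp
  moreover have "(x - (a + d)) / 2 - (x - (a + 2 * d)) / 2 = d / 2"
    by (simp add: field_simps)
  moreover have "sin (d / 2) > 0"
    using d pi_gt3 by (intro sin_gt_zero) auto
  ultimately show False by simp
qed

lemma osc_trig_poly_neq:
  assumes f: "smooth f" and "a < b" "\<And>t. t \<in> {a..b} \<Longrightarrow> \<not> hyper_osculates_at n f t"
  shows "osc_trig_poly n f a x \<noteq> osc_trig_poly n f b x"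
proof
  assume eq: "osc_trig_poly n f a x = osc_trig_poly n f b x"
  obtain \<sigma> where \<sigma>: "\<sigma> \<noteq> 0" "\<And>t. t \<in> {a..b} \<Longrightarrow> \<sigma> * osc_defect n f t > 0"
  proof (rule continuous_nonzero_constant_sign)
    show "continuous_on {a..b} (osc_defect n f)" by (rule continuous_osc_defect[OF f])
    show "osc_defect n f t \<noteq> 0" if "t \<in> {a..b}" for t
      using assms(3)[OF that] by (simp add: osc_defect_def hyper_osculates_at_def)
  qed auto
  define F where "F = (\<lambda>t. \<sigma> * osc_trig_poly n f t x)"
  have D: "(F has_real_derivative \<sigma> * osc_defect n f t * osc_kernel n (x - t)) (at t)" for t
    unfolding F_def using DERIV_cmult[OF DERIV_osc_trig_poly[OF f]] by (simp add: mult.assoc)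
  have mono: "F s \<le> F t" if "a \<le> s" "s \<le> t" "t \<le> b" for s t
  proof (rule DERIV_nonneg_imp_nondecreasing[OF that(2)])
    fix u assume "s \<le> u" "u \<le> t"
    hence "\<sigma> * osc_defect n f u \<ge> 0" using \<sigma>(2)[of u] that by simp
    hence "\<sigma> * osc_defect n f u * osc_kernel n (x - u) \<ge> 0"
      by (rule mult_nonneg_nonneg) (rule osc_kernel_nonneg)
    thus "\<exists>y. (F has_real_derivative y) (at u) \<and> 0 \<le> y" using D by blast
  qed
  obtain t where t: "a < t" "t < b" "sin ((x - t) / 2) \<noteq> 0"
    using exists_sin_nonzero[OF \<open>a < b\<close>] by blast
  \<comment> \<open>A monotone function with equal values at the ends is constant, but \<open>F\<close> has nonzero
    derivative at \<open>t\<close>.\<close>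
  have const: "F s = F t" if "s \<in> {a<..<b}" for s
    using mono[of a s] mono[of s b] mono[of a t] mono[of t b] eq that t by (auto simp: F_def)
  have "((\<lambda>_. F t) has_real_derivative \<sigma> * osc_defect n f t * osc_kernel n (x - t)) (at t)"
    by (rule has_field_derivative_transform_within_open[OF D, of "{a<..<b}"])
       (use t in simp, use t in simp, rule const)
  hence "\<sigma> * osc_defect n f t * osc_kernel n (x - t) = 0"
    using DERIV_unique DERIV_const by blast
  thus False using \<sigma>(2)[of t] t osc_kernel_eq_0D[of n "x - t"] by auto
qed

theorem theorem3:
  fixes f :: "real \<Rightarrow> real" and n :: nat and I :: "real set" and a b :: real
  assumes "smooth f"
    and "\<And>x. f (x + 2 * pi) = f x"
    and "n \<ge> 1"
    and "is_interval I"
    and "\<And>t. t \<in> I \<Longrightarrow> \<not> hyper_osculates_at n f t"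
    and "a \<in> I" and "b \<in> I" and "cis a \<noteq> cis b"
  shows "\<forall>x. osc_trig_poly n f a x \<noteq> osc_trig_poly n f b x"
proof
  fix x
  have sub: "{s..t} \<subseteq> I" if "s \<in> I" "t \<in> I" for s t
    using mem_is_interval_1_I[OF assms(4) that] by (simp add: subset_iff)
  have "a \<noteq> b" using assms(8) by blast
  then consider "a < b" | "b < a" by linarith
  thus "osc_trig_poly n f a x \<noteq> osc_trig_poly n f b x"
  proof cases
    case 1
    show ?thesis
      using sub[OF assms(6,7)] by (intro osc_trig_poly_neq[OF assms(1) 1] assms(5)) (rule subsetD)
  next
    case 2
    have "osc_trig_poly n f b x \<noteq> osc_trig_poly n f a x"
      using sub[OF assms(7,6)] by (intro osc_trig_poly_neq[OF assms(1) 2] assms(5)) (rule subsetD)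
    thus ?thesis by simp
  qed
qed

end
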